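(* Let $N=\{1,\dots,n\}$ and let $v=\sum_{S\in\Pi_v}\Delta_v(S)\,u_S$ be a regular cooperative game on $N$. Assume that $n=k\cdot m$ with $k,m\in\mathbb N$, $k\neq m$, and that $\Pi_v$ is the disjoint union $\Pi_v=\Pi^k\uplus\Pi^m$, where $\Pi^k$ is a partition of $N$ into $m$ sets of size $k$ and $\Pi^m$ is a partition of $N$ into $k$ sets of size $m$. If there exists some $\Delta\neq0$ such that $\Delta_v(S)=\Delta$ for all $S\in\Pi_v$, then the Gately value coincides with the Shapley value: $g(v)=\phi(v)$.
   Context: A cooperative game on $N$ is a function $v\colon 2^N\to\mathbb R$ with $v(\varnothing)=0$. Write $v_i=v(\{i\})$ and $M_i(v)=v(N)-v(N\setminus\{i\})$ for $i\in N$. The game $v$ is regular if: (essential) $\sum_{j\in N}v_j\leqslant v(N)\leqslant\sum_{j\in N}M_j(v)$; and (standard) $v_i\leqslant M_i(v)$ for every $i\in N$, with $v_j<M_j(v)$ for at least one $j\in N$. For nonempty $S\subseteq N$ the unanimity game $u_S$ is given by $u_S(T)=1$ if $S\subseteq T$ and $u_S(T)=0$ otherwise. Every game $v$ can be written uniquely as $v=\sum_{\varnothing\neq S\subseteq N}\Delta_v(S)\,u_S$ with Harsanyi dividends $\Delta_v(S)=\sum_{T\subseteq S}(-1)^{|S|-|T|}v(T)$, and $\Pi_v=\{S\subseteq N\mid S\neq\varnothing,\ \Delta_v(S)\neq0\}$. Here $\mathbb N$ denotes the positive integers. The Shapley value is $\phi_i(v)=\sum_{S\subseteq N\colon i\in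 S}\frac{\Delta_v(S)}{|S|}$, $i\in N$. The Gately value of a regular game is $$g_i(v)=v_i+\frac{M_i(v)-v_i}{\sum_{j\in N}(M_j(v)-v_j)}\Big(v(N)-\sum_{j\in N}v_j\Big),\qquad i\in N.$$ *)

theory Defs
  imports Complex_Main "HOL-Library.Disjoint_Sets"
begin

text \<open>
  Coalitional games on a finite player set \<open>N\<close>. A game is a set function on the whole powerset
  of the player type, but every definition below only evaluates it on subsets of \<open>N\<close>.
\<close>

definition cooperative_game :: "('a set \<Rightarrow> real) \<Rightarrow> bool" where
  "cooperative_game v \<longleftrightarrow> v {} = 0"

definition marginal :: "'a set \<Rightarrow> ('a set \<Rightarrow> real) \<Rightarrow> 'a \<Rightarrow> real" where
  "marginal N v i = v N - v (N - {i})"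

definition essential_game :: "'a set \<Rightarrow> ('a set \<Rightarrow> real) \<Rightarrow> bool" where
  "essential_game N v \<longleftrightarrow>
     (\<Sum>j\<in>N. v {j}) \<le> v N \<and> v N \<le> (\<Sum>j\<in>N. marginal N v j)"

definition standard_game :: "'a set \<Rightarrow> ('a set \<Rightarrow> real) \<Rightarrow> bool" where
  "standard_game N v \<longleftrightarrow>
     (\<forall>i\<in>N. v {i} \<le> marginal N v i) \<and> (\<exists>j\<in>N. v {j} < marginal N v j)"

definition regular_game :: "'a set \<Rightarrow> ('a set \<Rightarrow> real) \<Rightarrow> bool" where
  "regular_game N v \<longleftrightarrow> essential_game N v \<and> standard_game N v"

definition unanimity_game :: "'a set \<Rightarrow> 'a set \<Rightarrow> real" where
  "unanimity_game S T = (if S \<subseteq> T then 1 else 0)"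

definition harsanyi_dividend :: "('a set \<Rightarrow> real) \<Rightarrow> 'a set \<Rightarrow> real" where
  "harsanyi_dividend v S = (\<Sum>T\<in>Pow S. (-1) ^ (card S - card T) * v T)"

definition dividend_support :: "'a set \<Rightarrow> ('a set \<Rightarrow> real) \<Rightarrow> 'a set set" where
  "dividend_support N v = {S. S \<subseteq> N \<and> S \<noteq> {} \<and> harsanyi_dividend v S \<noteq> 0}"

definition shapley_value :: "'a set \<Rightarrow> ('a set \<Rightarrow> real) \<Rightarrow> 'a \<Rightarrow> real" where
  "shapley_value N v i =
     (\<Sum>S\<in>{S. S \<subseteq> N \<and> i \<in> S}. harsanyi_dividend v S / real (card S))"

definition gately_value :: "'a set \<Rightarrow> ('a set \<Rightarrow> real) \<Rightarrow> 'a \<Rightarrow> real" where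
  "gately_value N v i =
     v {i} + (marginal N v i - v {i}) / (\<Sum>j\<in>N. (marginal N v j - v {j}))
               * (v N - (\<Sum>j\<in>N. v {j}))"

text \<open>
  The expansion of a game in the unanimity basis holds for every game, so it never has to be
  imposed as a hypothesis.
\<close>

lemma harsanyi_expansion:
  assumes "finite T"
  shows "v T = (\<Sum>S\<in>Pow T. harsanyi_dividend v S)"
proof -
  define g where "g S = (-1) ^ card S * harsanyi_dividend v S" for S
  have g: "g S = (\<Sum>T\<in>Pow S. (-1) ^ card T * v T)" if "finite S" for S
  proof -
    have "(-1) ^ card S * ((-1) ^ (card S - card T) * v T) = (-1) ^ card T * v T"
      if "T \<in> Pow S" for T
    proof -
      have "card T \<le> card S"
        using that \<open>finite S\<close> by (auto intro: card_mono)
      then have "even (card S + (card S - card T)) = even (card T)"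
        by presburger
      then have "(-1::real) ^ (card S + (card S - card T)) = (-1) ^ card T"
        by (simp add: minus_one_power_iff)
      then show ?thesis
        by (simp add: power_add flip: mult.assoc)
    qed
    then show ?thesis
      unfolding g_def harsanyi_dividend_def sum_distrib_left by (intro sum.cong) auto
  qed
  have "v T = (\<Sum>S\<in>Pow T. (-1) ^ card S * g S)"
    using inclusion_exclusion_symmetric[of g v T] g assms by blast
  then show ?thesis
    by (simp add: g_def flip: mult.assoc power_add)
qed

lemma game_eq_sum_unanimity:
  assumes "finite N" and "cooperative_game v" and "T \<subseteq> N"
  shows "v T = (\<Sum>S\<in>dividend_support N v. harsanyi_dividend v S * unanimity_game S T)"
proof -
  have "finite T"
    using assms finite_subset by blast
  have "harsanyi_dividend v {} = 0"
    using assms(2) by (simp add: harsanyi_dividend_def cooperative_game_def)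
  then have "(\<Sum>S\<in>dividend_support N v. harsanyi_dividend v S * unanimity_game S T)
      = (\<Sum>S\<in>Pow N. harsanyi_dividend v S * unanimity_game S T)"
    using assms(1) by (intro sum.mono_neutral_left) (auto simp: dividend_support_def)
  also have "\<dots> = (\<Sum>S\<in>Pow T. harsanyi_dividend v S * unanimity_game S T)"
    using assms by (intro sum.mono_neutral_right) (auto simp: unanimity_game_def)
  also have "\<dots> = (\<Sum>S\<in>Pow T. harsanyi_dividend v S)"
    by (intro sum.cong) (auto simp: unanimity_game_def)
  finally show ?thesis
    using harsanyi_expansion[OF \<open>finite T\<close>, of v] by simp
qed

end

theory Submission
  imports Defs
begin

text \<open>
  Every player lies in exactly one block of each partition, so all marginal contributions equal
  \<open>2\<Delta>\<close>; the values \<open>v {i}\<close> also agree for all players, being \<open>\<Delta>\<close> if \<open>k = 1\<close> or \<open>m = 1\<close> and \<open>0\<close>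
  otherwise. Hence the Gately value splits \<open>v N = (k + m) \<Delta>\<close> equally, and the equal share
  \<open>(k + m) \<Delta> / (k m) = \<Delta> / k + \<Delta> / m\<close> is the Shapley value.
\<close>

text \<open>Expanding both worths into dividends, the coalitions that avoid \<open>i\<close> cancel.
  This writes marginal contributions as sums over the same coalitions as in the Shapley
  value.\<close>

lemma marginal_eq_sum_dividends:
  assumes "finite N"
  shows "marginal N v i = (\<Sum>S\<in>{S. S \<subseteq> N \<and> i \<in> S}. harsanyi_dividend v S)"
proof -
  have "(\<Sum>S\<in>Pow N. harsanyi_dividend v S) - (\<Sum>S\<in>Pow (N - {i}). harsanyi_dividend v S)
      = (\<Sum>S\<in>Pow N - Pow (N - {i}). harsanyi_dividend v S)"
    using assms by (intro sum_diff[symmetric]) auto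
  also have "Pow N - Pow (N - {i}) = {S. S \<subseteq> N \<and> i \<in> S}"
    by auto
  finally show ?thesis
    using assms by (simp add: marginal_def harsanyi_expansion[of N v]
        harsanyi_expansion[of "N - {i}" v])
qed

lemma harsanyi_dividend_singleton:
  assumes "cooperative_game v"
  shows "harsanyi_dividend v {i} = v {i}"
  using assms by (simp add: harsanyi_dividend_def cooperative_game_def Pow_insert)

text \<open>With equal data for all players the quotient in the Gately value is
  \<open>1 / card N\<close>, and the two contributions of \<open>a\<close> cancel. The strict
  inequality in \<open>standard_game\<close> makes the denominator \<open>card N * (b - a)\<close>
  nonzero.\<close>

lemma gately_value_equal_share:
  assumes "finite N" and "standard_game N v" and "i \<in> N"
    and "\<And>j. j \<in> N \<Longrightarrow> v {j} = a" and "\<And>j. j \<in> N \<Longrightarrow> marginal N v j = b"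
  shows "gately_value N v i = v N / real (card N)"
proof -
  have "b - a \<noteq> 0"
    using assms by (force simp: standard_game_def)
  moreover have "card N \<noteq> 0"
    using assms by auto
  ultimately show ?thesis
    using assms by (simp add: gately_value_def field_simps)
qed

lemma partition_on_block_of:
  assumes "partition_on N P" and "i \<in> N"
  obtains A where "A \<in> P" and "{S \<in> P. i \<in> S} = {A}"
proof -
  obtain A where A: "A \<in> P" "i \<in> A"
    using assms by (auto simp: partition_on_def)
  moreover have "S = A" if "S \<in> P" "i \<in> S" for S
    using that A assms(1) by (auto simp: partition_on_def disjoint_def)
  ultimately have "{S \<in> P. i \<in> S} = {A}"
    by blast
  with A show thesis
    using that by blast
qed

text \<open>Decides when a player's own worth, which is the dividend of \<open>{i}\<close>, can be
  nonzero.\<close>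

lemma singleton_in_uniform_partition_iff:
  assumes "partition_on N P" and "\<And>S. S \<in> P \<Longrightarrow> card S = k" and "i \<in> N"
  shows "{i} \<in> P \<longleftrightarrow> k = 1"
proof
  assume "k = 1"
  obtain S where "S \<in> P" "i \<in> S"
    using assms(1,3) by (auto simp: partition_on_def)
  with assms(2) \<open>k = 1\<close> show "{i} \<in> P"
    by (metis card_1_singletonE singletonD)
qed (use assms(2) in force)

theorem proposition5p11:
  fixes n k m :: nat
    and N :: "nat set"
    and v :: "nat set \<Rightarrow> real"
    and Pk Pm :: "nat set set"
  assumes "N = {1..n}"
    and "cooperative_game v"
    and "regular_game N v"
    and "n = k * m" and "k \<ge> 1" and "m \<ge> 1" and "k \<noteq> m"
    and "dividend_support N v = Pk \<union> Pm" and "Pk \<inter> Pm = {}"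
    and "partition_on N Pk" and "card Pk = m" and "\<forall>S\<in>Pk. card S = k"
    and "partition_on N Pm" and "card Pm = k" and "\<forall>S\<in>Pm. card S = m"
    and "\<exists>\<Delta>. \<Delta> \<noteq> 0 \<and> (\<forall>S\<in>dividend_support N v. harsanyi_dividend v S = \<Delta>)"
  shows "\<forall>i\<in>N. gately_value N v i = shapley_value N v i"
proof
  fix i assume i: "i \<in> N"
  have fin: "finite N"
    using assms(1) by simp
  obtain \<Delta> where \<Delta>: "\<And>S. S \<in> Pk \<union> Pm \<Longrightarrow> harsanyi_dividend v S = \<Delta>"
    using assms(8,16) by auto
  \<comment> \<open>The support excludes the empty set by definition, so that case needs
    \<open>v {} = 0\<close> instead.\<close>
  have zero: "harsanyi_dividend v S = 0" if "S \<subseteq> N" "S \<notin> Pk \<union> Pm" for S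
    using that assms(2) unfolding assms(8)[symmetric]
    by (cases "S = {}") (auto simp: dividend_support_def harsanyi_dividend_def cooperative_game_def)
  have sub: "Pk \<union> Pm \<subseteq> Pow N"
    using assms(8) by (auto simp: dividend_support_def)
  have finP: "finite (Pk \<union> Pm)"
    using sub fin by (meson finite_Pow_iff finite_subset)
  \<comment> \<open>The weight \<open>g\<close> covers two uses at once: the constant 1 gives
    marginal contributions, and \<open>real\<close> gives the Shapley value.\<close>
  have dividends: "(\<Sum>S\<in>{S. S \<subseteq> N \<and> j \<in> S}. harsanyi_dividend v S / g (card S))
      = \<Delta> / g k + \<Delta> / g m" if j: "j \<in> N" for j and g :: "nat \<Rightarrow> real"
  proof -
    obtain A where A: "A \<in> Pk" "{S \<in> Pk. j \<in> S} = {A}"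
      using partition_on_block_of[OF assms(10) j] .
    obtain B where B: "B \<in> Pm" "{S \<in> Pm. j \<in> S} = {B}"
      using partition_on_block_of[OF assms(13) j] .
    \<comment> \<open>Disjointness of \<open>Pk\<close> and \<open>Pm\<close> keeps the two blocks
      of \<open>j\<close> from merging into one term.\<close>
    have "A \<noteq> B"
      using A B assms(9) by blast
    have "(\<Sum>S\<in>{S. S \<subseteq> N \<and> j \<in> S}. harsanyi_dividend v S / g (card S))
        = (\<Sum>S\<in>{A, B}. harsanyi_dividend v S / g (card S))"
    proof (intro sum.mono_neutral_right ballI)
      show "finite {S. S \<subseteq> N \<and> j \<in> S}"
        using fin by simp
      show "{A, B} \<subseteq> {S. S \<subseteq> N \<and> j \<in> S}"
        using A B sub by blast
      fix S assume S: "S \<in> {S. S \<subseteq> N \<and> j \<in> S} - {A, B}"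
      then have "S \<notin> Pk \<union> Pm"
        using A B by blast
      with S zero show "harsanyi_dividend v S / g (card S) = 0"
        by simp
    qed
    with A B \<open>A \<noteq> B\<close> \<Delta> assms(12,15) show ?thesis
      by simp
  qed
  have marg: "marginal N v j = 2 * \<Delta>" if "j \<in> N" for j
    using dividends[OF that, of "\<lambda>_. 1"] by (simp add: marginal_eq_sum_dividends[OF fin])
  have single: "v {j} = (if k = 1 \<or> m = 1 then \<Delta> else 0)" if j: "j \<in> N" for j
  proof -
    have "{j} \<in> Pk \<longleftrightarrow> k = 1" "{j} \<in> Pm \<longleftrightarrow> m = 1"
      using singleton_in_uniform_partition_iff[OF assms(10) _ j, of k]
        singleton_in_uniform_partition_iff[OF assms(13) _ j, of m] assms(12,15) by blast+
    then show ?thesis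
      using \<Delta>[of "{j}"] zero[of "{j}"] j harsanyi_dividend_singleton[OF assms(2), of j] by auto
  qed
  \<comment> \<open>The grand coalition contains every block: \<open>m\<close> from
    \<open>Pk\<close> and \<open>k\<close> from \<open>Pm\<close>, each contributing
    \<Delta>.\<close>
  have "v N = (\<Sum>S\<in>Pk \<union> Pm. harsanyi_dividend v S)"
    unfolding harsanyi_expansion[OF fin, of v]
    using sub fin zero by (intro sum.mono_neutral_right) auto
  also have "\<dots> = (real k + real m) * \<Delta>"
    using \<Delta> finP assms(9,11,14) by (simp add: card_Un_disjoint)
  finally have grand: "v N = (real k + real m) * \<Delta>" .
  have "gately_value N v i = v N / real (card N)"
    using assms(3) by (intro gately_value_equal_share[OF fin _ i single marg])
      (auto simp: regular_game_def)
  also have "\<dots> = \<Delta> / real k + \<Delta> / real m"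
    using grand assms(1,4-6) by (simp add: field_simps)
  also have "\<dots> = shapley_value N v i"
    using dividends[OF i, of real] by (simp add: shapley_value_def)
  finally show "gately_value N v i = shapley_value N v i" .
qed

end
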